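(* Let $g$ be a polynomial of degree at least $2$. For every $\lambda>1$ and $\epsilon_0>0$ there exist $\rho>0$, positive integers $N,\tilde n$ and $\alpha>0$ (depending only on $g,\lambda,\epsilon_0$) such that the following holds. Let $z\in J(g)$ and $m\in\mathbb{Z}^+$ satisfy $$\frac1m\log|Dg^m(z)|>\epsilon_0+\log\lambda.$$ Then there is a subset $H_m\subset\{1,2,\dots,m\}$ such that: (a) $\#H_m\ge\alpha m$; (b) for every $n\in H_m$, if $V_n$ is the connected component of $g^{-n}(B(g^n(z),\rho))$ containing $z$, then $g^n:V_n\to B(g^n(z),\rho)$ is at most $N$-critical; (c) $V_n\subset B(z,\lambda^{-n}\rho)$ whenever $n\in H_m$ and $n\ge\tilde n$.
   Context: $J(g)$ is the Julia set of $g$. A map $g^n:V_n\to B(g^n(z),\rho)$ (with $V_n$ a component of the preimage of the disk) is called at most $N$-critical if the number of indices $j\in\{0,1,\dots,n-1\}$ such that $g^j(V_n)$ contains a critical point of $g$ is at most $N$. *)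

theory Defs
  imports "HOL-Analysis.Analysis" "HOL-Computational_Algebra.Polynomial"
begin

definition chordal_dist :: "complex \<Rightarrow> complex \<Rightarrow> real" where
  "chordal_dist z w = 2 * cmod (z - w) / sqrt ((1 + (cmod z)\<^sup>2) * (1 + (cmod w)\<^sup>2))"

text \<open>Fatou set (Beardon's definition): the points having an open neighbourhood on which the
  family of iterates is equicontinuous with respect to the chordal metric.\<close>
definition fatou_set :: "complex poly \<Rightarrow> complex set" where
  "fatou_set g = {z. \<exists>U. open U \<and> z \<in> U \<and>
      (\<forall>w\<in>U. \<forall>e>0. \<exists>d>0. \<forall>n::nat. \<forall>u\<in>U. cmod (u - w) < d \<longrightarrow>
          chordal_dist ((poly g ^^ n) u) ((poly g ^^ n) w) < e)}"

definition julia_set :: "complex poly \<Rightarrow> complex set" where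
  "julia_set g = - fatou_set g"

definition crit_points :: "complex poly \<Rightarrow> complex set" where
  "crit_points g = {c. poly (pderiv g) c = 0}"

definition at_most_N_critical :: "complex poly \<Rightarrow> nat \<Rightarrow> complex set \<Rightarrow> nat \<Rightarrow> bool" where
  "at_most_N_critical g n V N \<longleftrightarrow>
     card {j \<in> {0..<n}. (poly g ^^ j) ` V \<inter> crit_points g \<noteq> {}} \<le> N"

end

theory Submission
  imports Defs "HOL-Computational_Algebra.Fundamental_Theorem_Algebra"
begin

text \<open>Write \<open>z\<^sub>j = g\<^sup>j(z)\<close> and \<open>a\<^sub>j = \<bar>g'(z\<^sub>j)\<bar>\<close>. By Pliss's argument a positive proportion
  of the times \<open>n \<le> m\<close> are hyperbolic: \<open>g\<close> expands from every \<open>z\<^sub>k\<close> to \<open>z\<^sub>n\<close> at an exponential rate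
  slightly better than \<open>\<lambda>\<close>. A time \<open>j < n\<close> shadows \<open>n\<close> if \<open>a\<^sub>j\<^sup>2 < e\<^bsup>-\<kappa>(n - 1 - j)\<^esup>\<close>. Since the \<open>a\<^sub>j\<close> are
  bounded above and their product is at least \<open>1\<close>, the shadows have total length \<open>O(m)\<close>, so all
  but a small proportion of the \<open>n\<close> lie in at most \<open>N\<close> of them. For a hyperbolic \<open>n\<close> in at most
  \<open>N\<close> shadows, the disk around \<open>z\<^sub>n\<close> is pulled back one step at a time. A step at a shadowing
  time \<open>j\<close> multiplies the radius by at most \<open>8 ^ degree g / a\<^sub>j\<close>, whatever the position of the
  critical points; at any other time the pullback is so small compared with \<open>a\<^sub>j\<close> that it avoids the
  critical points and the factor is at most \<open>e\<^sup>\<delta> / a\<^sub>j\<close>. The hyperbolicity of \<open>n\<close> absorbs all factors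
  except \<open>(8 ^ degree g) ^ N\<close>, which is compensated by the choice of \<open>\<rho>\<close> and \<open>n\<^sub>0\<close>.\<close>

section \<open>One-step pullbacks of disks under a polynomial\<close>

text \<open>Used to trap a connected pullback in a disk: it then suffices to bound the displacement
  of the image from below on a single circle.\<close>

lemma connected_subset_ball_if_avoids_sphere:
  fixes y :: "'a::euclidean_space"
  assumes "connected W" "y \<in> W" "t > 0" "\<And>x. x \<in> W \<Longrightarrow> dist y x \<noteq> t"
  shows "W \<subseteq> ball y t"
proof (rule ccontr)
  assume "\<not> W \<subseteq> ball y t"
  then have "W \<inter> frontier (ball y t) \<noteq> {}"
    using assms by (intro connected_Int_frontier) auto
  then show False using assms by auto
qed

text \<open>Pigeonhole: each of the \<open>degree q\<close> roots is close to at most one of the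
  \<open>degree q + 1\<close> radii \<open>4 ^ k * t0\<close>, so some radius differs by a factor of
  at least 2 from the distance of \<open>y\<close> to every root. On that circle each linear factor
  is at least half its value at \<open>y\<close>.\<close>

lemma poly_lower_bound_on_circle:
  fixes q :: "complex poly"
  assumes "t0 > 0"
  obtains t where "t0 \<le> t" "t \<le> 4 ^ degree q * t0"
    "\<And>x. cmod (x - y) = t \<Longrightarrow> cmod (poly q y) \<le> 2 ^ degree q * cmod (poly q x)"
proof -
  obtain a where a: "smult (lead_coeff q) (\<Prod>i<degree q. [:-a i, 1:]) = q"
    by (rule complex_poly_decompose')
  have val: "cmod (poly q x) = cmod (lead_coeff q) * (\<Prod>i<degree q. cmod (x - a i))" for x
    by (subst a[symmetric], simp only: poly_smult poly_prod norm_mult prod_norm) simp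
  define close where "close k i \<longleftrightarrow> i < degree q \<and>
    cmod (y - a i) / 2 < 4 ^ k * t0 \<and> 4 ^ k * t0 < 2 * cmod (y - a i)" for k i :: nat
  have "\<exists>k\<le>degree q. \<forall>i. \<not> close k i"
  proof (rule ccontr)
    assume "\<not> ?thesis"
    then obtain f where f: "close k (f k)" if "k \<le> degree q" for k
      by metis
    have sep: "f k \<noteq> f l" if "k < l" "l \<le> degree q" for k l
    proof
      assume eq: "f k = f l"
      \<comment> \<open>With \<open>d\<close> the distance from \<open>y\<close> to the root, close
        radii lie strictly between \<open>d / 2\<close> and \<open>2 * d\<close>; these endpoints
        have ratio 4, so two of the radii cannot both fit.\<close>
      have "(4::real) ^ Suc k \<le> 4 ^ l" using that by (intro power_increasing) auto
      then have "4 * (4 ^ k * t0) \<le> 4 ^ l * t0" using assms by simp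
      then show False using f[of k] f[of l] that eq unfolding close_def by auto
    qed
    have "inj_on f {..degree q}"
      using sep by (intro inj_onI) (metis atMost_iff linorder_neqE_nat)
    moreover have "f ` {..degree q} \<subseteq> {..<degree q}"
      using f unfolding close_def by auto
    ultimately have "card {..degree q} \<le> card {..<degree q}"
      by (rule card_inj_on_le) auto
    then show False by simp
  qed
  then obtain k where k: "k \<le> degree q" "\<And>i. \<not> close k i" by blast
  define t where "t = 4 ^ k * t0"
  show ?thesis
  proof (rule that[of t])
    show "t0 \<le> t" using assms unfolding t_def by simp
    show "t \<le> 4 ^ degree q * t0"
      using assms k(1) unfolding t_def by (simp add: power_increasing)
    fix x assume x: "cmod (x - y) = t"
    have "cmod (y - a i) \<le> 2 * cmod (x - a i)" if "i < degree q" for i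
    proof -
      have "t \<le> cmod (y - a i) / 2 \<or> 2 * cmod (y - a i) \<le> t"
        using k(2)[of i] that unfolding close_def t_def by auto
      moreover have "cmod (y - a i) \<le> cmod (x - a i) + t"
        using norm_triangle_ineq4[of "x - a i" "x - y"] x by simp
      moreover have "t \<le> cmod (x - a i) + cmod (y - a i)"
        using norm_triangle_ineq4[of "x - a i" "y - a i"] x by simp
      ultimately show ?thesis by linarith
    qed
    then have "(\<Prod>i<degree q. cmod (y - a i)) \<le> (\<Prod>i<degree q. 2 * cmod (x - a i))"
      by (intro prod_mono) auto
    also have "\<dots> = 2 ^ degree q * (\<Prod>i<degree q. cmod (x - a i))"
      by (simp add: prod.distrib)
    finally have "cmod (lead_coeff q) * (\<Prod>i<degree q. cmod (y - a i))
        \<le> cmod (lead_coeff q) * (2 ^ degree q * (\<Prod>i<degree q. cmod (x - a i)))"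
      by (rule mult_left_mono) simp
    then show "cmod (poly q y) \<le> 2 ^ degree q * cmod (poly q x)"
      by (simp only: val mult_ac)
  qed
qed

text \<open>Factor \<open>g x - g y = (x - y) * q x\<close>, so that \<open>q y\<close> is the
  derivative at \<open>y\<close>. On the circle found for \<open>q\<close> the image stays at
  distance at least \<open>r\<close> from \<open>g y\<close>, so \<open>W\<close> cannot cross it.
  The base 8 is 2 from the loss in \<open>q\<close> times 4 from the choice of the circle; critical
  points may lie in \<open>W\<close>.\<close>

lemma connected_preimage_ball_subset:
  fixes g :: "complex poly"
  assumes "connected W" "y \<in> W" "poly g ` W \<subseteq> ball (poly g y) r"
    and d0: "poly (pderiv g) y \<noteq> 0" and r: "r > 0"
  shows "W \<subseteq> ball y (8 ^ degree g * r / cmod (poly (pderiv g) y))"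
proof -
  have "poly (g - [:poly g y:]) y = 0" by simp
  then obtain q where q: "g - [:poly g y:] = [:-y, 1:] * q"
    unfolding poly_eq_0_iff_dvd by (elim dvdE)
  have g_eq: "poly g x - poly g y = (x - y) * poly q x" for x
    using arg_cong[OF q, of "\<lambda>p. poly p x"] by (simp add: algebra_simps)
  have "pderiv g = pderiv ([:-y, 1:] * q)"
    using arg_cong[OF q, of pderiv] by (simp add: pderiv_diff pderiv_pCons)
  then have dq: "poly (pderiv g) y = poly q y"
    by (simp only: pderiv_mult) (simp add: pderiv_pCons)
  have "q \<noteq> 0" using dq d0 by auto
  have "degree (g - [:poly g y:]) \<le> degree g"
    by (rule degree_diff_le) auto
  then have deg: "Suc (degree q) \<le> degree g"
    unfolding q using \<open>q \<noteq> 0\<close> by (subst (asm) degree_mult_eq) auto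
  define b where "b = cmod (poly q y)"
  have b: "b > 0" using dq d0 unfolding b_def by auto
  \<comment> \<open>The radius at which the lower bound \<open>t * b / 2 ^ degree q\<close> for the
    displacement of the image reaches \<open>r\<close>.\<close>
  define t0 where "t0 = 2 ^ degree q * r / b"
  have "t0 > 0" using r b unfolding t0_def by auto
  then obtain t where t: "t0 \<le> t" "t \<le> 4 ^ degree q * t0"
    and low: "\<And>x. cmod (x - y) = t \<Longrightarrow> b \<le> 2 ^ degree q * cmod (poly q x)"
    using poly_lower_bound_on_circle[of t0 q y] unfolding b_def by metis
  have "W \<subseteq> ball y t"
  proof (rule connected_subset_ball_if_avoids_sphere)
    show "t > 0" using t \<open>t0 > 0\<close> by linarith
    fix x assume "x \<in> W"
    show "dist y x \<noteq> t"
    proof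
      assume "dist y x = t"
      then have x: "cmod (x - y) = t" by (simp add: dist_norm norm_minus_commute)
      have "2 ^ degree q * r = t0 * b" using b unfolding t0_def by simp
      also have "\<dots> \<le> t * (2 ^ degree q * cmod (poly q x))"
        using t(1) low[OF x] \<open>t0 > 0\<close> b by (intro mult_mono) auto
      also have "\<dots> = 2 ^ degree q * cmod (poly g x - poly g y)"
        unfolding g_eq norm_mult x by simp
      finally have "r \<le> cmod (poly g x - poly g y)" by simp
      moreover have "poly g x \<in> ball (poly g y) r" using \<open>x \<in> W\<close> assms(3) by auto
      ultimately show False by (simp add: dist_norm norm_minus_commute)
    qed
  qed (use assms in auto)
  also have "t \<le> 8 ^ degree g * r / b"
  proof -
    have "t \<le> 8 ^ degree q * r / b"
      using t(2) unfolding t0_def by (simp flip: power_mult_distrib add: mult.assoc[symmetric])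
    also have "\<dots> \<le> 8 ^ degree g * r / b"
      using deg r b by (intro divide_right_mono mult_right_mono power_increasing) auto
    finally show ?thesis .
  qed
  then have "ball y t \<subseteq> ball y (8 ^ degree g * r / b)" by (rule subset_ball)
  finally show ?thesis unfolding dq b_def .
qed

text \<open>Mean value inequality, with \<open>M\<close> bounding the second derivative on the disk
  of radius \<open>R + 1\<close>; one \<open>M\<close> serves all base points in the disk of radius
  \<open>R\<close>.\<close>

lemma poly_quadratic_remainder:
  fixes g :: "complex poly"
  obtains M where "M > 0"
    "\<And>x y. \<lbrakk>cmod y \<le> R; cmod (x - y) \<le> 1\<rbrakk> \<Longrightarrow>
       cmod (poly (pderiv g) x - poly (pderiv g) y) \<le> M * cmod (x - y)"
    "\<And>x y. \<lbrakk>cmod y \<le> R; cmod (x - y) \<le> 1\<rbrakk> \<Longrightarrow>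
       cmod (poly g x - poly g y - poly (pderiv g) y * (x - y)) \<le> M * cmod (x - y) ^ 2"
proof -
  have "bounded (poly (pderiv (pderiv g)) ` cball 0 (R + 1))"
    by (intro compact_imp_bounded compact_continuous_image continuous_intros compact_cball)
  then obtain M where "M > 0" and M: "\<And>x. cmod x \<le> R + 1 \<Longrightarrow> cmod (poly (pderiv (pderiv g)) x) \<le> M"
    unfolding bounded_pos by auto
  have in_ball: "cmod x \<le> R + 1" if "cmod y \<le> R" "cmod (x - y) \<le> 1" for x y :: complex
    using norm_triangle_ineq[of y "x - y"] that by simp
  have lip: "cmod (poly (pderiv g) x - poly (pderiv g) y) \<le> M * cmod (x - y)"
    if "cmod y \<le> R" "cmod (x - y) \<le> 1" for x y
    using that in_ball[OF that]
    by (intro field_differentiable_bound[where S = "cball 0 (R + 1)" and f' = "poly (pderiv (pderiv g))"])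
       (auto intro!: DERIV_subset[OF poly_DERIV] M)
  have "cmod (poly g x - poly g y - poly (pderiv g) y * (x - y)) \<le> M * cmod (x - y) ^ 2"
    if "cmod y \<le> R" "cmod (x - y) \<le> 1" for x y
  proof -
    let ?S = "cball y (cmod (x - y))"
    \<comment> \<open>Subtracting the linear part makes the derivative at most
      \<open>M * cmod (x - y)\<close> on \<open>?S\<close>.\<close>
    have "cmod ((poly g x - poly (pderiv g) y * x) - (poly g y - poly (pderiv g) y * y))
        \<le> (M * cmod (x - y)) * cmod (x - y)"
    proof (rule field_differentiable_bound[where S = ?S and f' = "\<lambda>u. poly (pderiv g) u - poly (pderiv g) y"])
      fix u assume "u \<in> ?S"
      then have u: "cmod (u - y) \<le> cmod (x - y)" by (simp add: dist_norm norm_minus_commute)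
      show "((\<lambda>x. poly g x - poly (pderiv g) y * x) has_field_derivative
          poly (pderiv g) u - poly (pderiv g) y) (at u within ?S)"
        by (auto intro!: derivative_eq_intros DERIV_subset[OF poly_DERIV])
      have "cmod (poly (pderiv g) u - poly (pderiv g) y) \<le> M * cmod (u - y)"
        using u that by (intro lip) auto
      also have "\<dots> \<le> M * cmod (x - y)" using u \<open>M > 0\<close> by simp
      finally show "cmod (poly (pderiv g) u - poly (pderiv g) y) \<le> M * cmod (x - y)" .
    qed (auto simp: dist_norm norm_minus_commute)
    then show ?thesis by (simp add: algebra_simps power2_eq_square)
  qed
  with lip \<open>M > 0\<close> show ?thesis using that by blast
qed

text \<open>Away from the critical points, on the scale \<open>r \<le> \<rho> \<bar>g'(y)\<bar>\<^sup>2\<close>, the distortion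
  constant \<open>8 ^ degree g\<close> improves to any prescribed \<open>E > 1\<close>.\<close>

lemma connected_preimage_small_ball:
  fixes g :: "complex poly"
  assumes "E > 1"
  obtains rho where "rho > 0"
    "\<And>y W r. \<lbrakk>cmod y \<le> R; poly (pderiv g) y \<noteq> 0; r > 0; r \<le> rho * cmod (poly (pderiv g) y) ^ 2;
       connected W; y \<in> W; poly g ` W \<subseteq> ball (poly g y) r\<rbrakk> \<Longrightarrow>
       W \<subseteq> ball y (E * r / cmod (poly (pderiv g) y)) \<and> W \<inter> crit_points g = {}"
proof -
  obtain M where M: "M > 0"
    and lip: "\<And>x y. \<lbrakk>cmod y \<le> R; cmod (x - y) \<le> 1\<rbrakk> \<Longrightarrow>
       cmod (poly (pderiv g) x - poly (pderiv g) y) \<le> M * cmod (x - y)"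
    and quad: "\<And>x y. \<lbrakk>cmod y \<le> R; cmod (x - y) \<le> 1\<rbrakk> \<Longrightarrow>
       cmod (poly g x - poly g y - poly (pderiv g) y * (x - y)) \<le> M * cmod (x - y) ^ 2"
    using poly_quadratic_remainder[of R g] by metis
  have "bounded (poly (pderiv g) ` cball 0 R)"
    by (intro compact_imp_bounded compact_continuous_image continuous_intros compact_cball)
  then obtain L where "L > 0" and L: "\<And>y. cmod y \<le> R \<Longrightarrow> cmod (poly (pderiv g) y) \<le> L"
    unfolding bounded_pos by auto
  \<comment> \<open>The first bound makes the new radius \<open>s\<close> at most 1, so that the
    remainder estimates apply; the second keeps the nonlinear error below a fraction
    \<open>1 - 1 / E\<close> of the linear term.\<close>
  define rho where "rho = min (1 / (E * L)) ((1 - 1 / E) / (E * M))"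
  have rho: "rho > 0" "E * rho * L \<le> 1" "M * (E * rho) \<le> 1 - 1 / E"
  proof -
    show "rho > 0" using assms M \<open>L > 0\<close> unfolding rho_def by auto
    have "rho \<le> 1 / (E * L)" "rho \<le> (1 - 1 / E) / (E * M)" unfolding rho_def by auto
    then show "E * rho * L \<le> 1" "M * (E * rho) \<le> 1 - 1 / E"
      using assms M \<open>L > 0\<close> by (simp_all add: pos_le_divide_eq mult_ac)
  qed
  show ?thesis
  proof (rule that[OF rho(1)])
    fix y W r
    assume y: "cmod y \<le> R" and d0: "poly (pderiv g) y \<noteq> 0" and r: "r > 0"
      and r_le: "r \<le> rho * cmod (poly (pderiv g) y) ^ 2"
      and W: "connected W" "y \<in> W" "poly g ` W \<subseteq> ball (poly g y) r"
    define a where "a = cmod (poly (pderiv g) y)"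
    define s where "s = E * r / a"
    have a: "a > 0" "a \<le> L" using d0 L[OF y] unfolding a_def by auto
    have s: "s > 0" using assms r a unfolding s_def by simp
    have s_le: "s \<le> E * rho * a"
      using r_le assms a unfolding s_def a_def[symmetric]
      by (simp add: field_simps power2_eq_square)
    also have "\<dots> \<le> E * rho * L" using a assms rho by (intro mult_left_mono) auto
    finally have s1: "s \<le> 1" using rho by linarith
    have "M * s \<le> (M * (E * rho)) * a" using s_le M by (simp add: mult_ac)
    also have "\<dots> \<le> (1 - 1 / E) * a" using rho a by (intro mult_right_mono) auto
    finally have Ms: "a / E \<le> a - M * s" by (simp add: algebra_simps)
    have sub: "W \<subseteq> ball y s"
    proof (rule connected_subset_ball_if_avoids_sphere[OF W(1,2) s])
      fix x assume "x \<in> W"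
      show "dist y x \<noteq> s"
      proof
        assume "dist y x = s"
        then have x: "cmod (x - y) = s" by (simp add: dist_norm norm_minus_commute)
        have "r = s * (a / E)" using assms a unfolding s_def by simp
        also have "\<dots> \<le> s * (a - M * s)" using Ms s by (intro mult_left_mono) auto
        also have "\<dots> = cmod (poly (pderiv g) y * (x - y)) - M * cmod (x - y) ^ 2"
          unfolding norm_mult x a_def by (simp add: algebra_simps power2_eq_square)
        also have "\<dots> \<le> cmod (poly g x - poly g y)"
          using quad[of y x] y x s1
            norm_triangle_ineq4[of "poly g x - poly g y"
              "poly g x - poly g y - poly (pderiv g) y * (x - y)"] by simp
        finally have "r \<le> cmod (poly g x - poly g y)" .
        moreover have "poly g x \<in> ball (poly g y) r" using \<open>x \<in> W\<close> W(3) by auto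
        ultimately show False by (simp add: dist_norm norm_minus_commute)
      qed
    qed
    \<comment> \<open>Within distance \<open>s\<close> of \<open>y\<close> the derivative changes by
      less than \<open>a\<close>, so it cannot vanish.\<close>
    have "poly (pderiv g) x \<noteq> 0" if "x \<in> W" for x
    proof
      assume 0: "poly (pderiv g) x = 0"
      have x: "cmod (x - y) < s" using sub that by (auto simp: dist_norm norm_minus_commute)
      have "a \<le> M * cmod (x - y)" using lip[of y x] y x s1 0 unfolding a_def by simp
      also have "\<dots> \<le> M * s" using x M by simp
      also have "\<dots> < a" using Ms a assms by (smt (verit) divide_pos_pos)
      finally show False by simp
    qed
    with sub show "W \<subseteq> ball y (E * r / cmod (poly (pderiv g) y)) \<and> W \<inter> crit_points g = {}"
      unfolding s_def a_def crit_points_def by auto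
  qed
qed

section \<open>Density of hyperbolic times with few shadows\<close>

text \<open>Pliss's lemma, by induction on \<open>m\<close>: if \<open>Suc m\<close> is a counted
  time, the count gains one and the sum at most \<open>A\<close>; otherwise a negative suffix sum
  bounds the sum by that of a shorter prefix.\<close>

lemma card_nonneg_suffix_sums_ge:
  fixes c :: "nat \<Rightarrow> real"
  assumes "\<And>j. c j \<le> A" "A \<ge> 0"
  shows "sum c {..<m} \<le> A * card {n \<in> {1..m}. \<forall>k<n. 0 \<le> sum c {k..<n}}"
proof -
  define H where "H m = {n \<in> {1..m}. \<forall>k<n. 0 \<le> sum c {k..<n}}" for m :: nat
  have fin: "finite (H m)" for m unfolding H_def by simp
  \<comment> \<open>Stated for all prefixes, since the shorter prefix may have any length up to
    \<open>m\<close>.\<close>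
  have "\<forall>k\<le>m. sum c {..<k} \<le> A * card (H m)"
  proof (induction m)
    case 0
    then show ?case using assms(2) by simp
  next
    case (Suc m)
    have mono: "A * card (H m) \<le> A * card (H (Suc m))"
      using assms(2) fin by (intro mult_left_mono of_nat_mono card_mono) (auto simp: H_def)
    have "sum c {..<Suc m} \<le> A * card (H (Suc m))"
    proof (cases "Suc m \<in> H (Suc m)")
      case True
      then have "H (Suc m) = insert (Suc m) (H m)" unfolding H_def by (auto simp: le_Suc_eq)
      then have "card (H (Suc m)) = Suc (card (H m))"
        using fin by (simp add: H_def)
      then show ?thesis using Suc assms(1)[of m] by (simp add: algebra_simps add_mono)
    next
      case False
      then obtain k where k: "k < Suc m" "sum c {k..<Suc m} < 0" unfolding H_def by force
      have "sum c {..<Suc m} = sum c {..<k} + sum c {k..<Suc m}"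
        using k sum.atLeastLessThan_concat[of 0 k "Suc m" c] by (simp add: atLeast0LessThan)
      moreover have "sum c {..<k} \<le> A * card (H m)" using Suc k by simp
      ultimately show ?thesis using k mono by linarith
    qed
    then show ?case using Suc mono by (force simp: le_Suc_eq)
  qed
  then show ?thesis unfolding H_def by blast
qed

text \<open>The index \<open>j\<close> casts a shadow of length proportional to \<open>- l j\<close> on the later times
  \<open>n\<close>; here \<open>l j\<close> will be the logarithm of the derivative at time \<open>j\<close>.\<close>

definition shadowing :: "(nat \<Rightarrow> real) \<Rightarrow> real \<Rightarrow> nat \<Rightarrow> nat set" where
  "shadowing l \<kappa> n = {j. j < n \<and> 2 * l j < - \<kappa> * (real n - 1 - real j)}"

lemma finite_shadowing [simp]: "finite (shadowing l \<kappa> n)"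
  unfolding shadowing_def by simp

text \<open>Double counting: each \<open>j\<close> shadows at most
  \<open>1 + 2 * (A - l j) / \<kappa>\<close> times, and in the sum over \<open>j\<close> the terms
  \<open>- l j\<close> contribute at most 0.\<close>

lemma sum_card_shadowing_le:
  assumes "\<kappa> > 0" "\<And>j. l j \<le> A" "A \<ge> 0" "0 \<le> sum l {..<m}"
  shows "(\<Sum>n\<in>{1..m}. real (card (shadowing l \<kappa> n))) \<le> real m * (1 + 2 * A / \<kappa>)"
proof -
  define P where "P n j \<longleftrightarrow> j \<in> shadowing l \<kappa> n" for n j
  have "(\<Sum>n\<in>{1..m}. real (card (shadowing l \<kappa> n))) = (\<Sum>n\<in>{1..m}. \<Sum>j<m. of_bool (P n j))"
  proof (intro sum.cong refl)
    fix n assume "n \<in> {1..m}"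
    then have "{..<m} \<inter> {j. P n j} = shadowing l \<kappa> n"
      unfolding P_def shadowing_def by auto
    then show "real (card (shadowing l \<kappa> n)) = (\<Sum>j<m. of_bool (P n j))"
      by simp
  qed
  also have "\<dots> = (\<Sum>j<m. \<Sum>n\<in>{1..m}. of_bool (P n j))" by (rule sum.swap)
  also have "\<dots> \<le> (\<Sum>j<m. 1 + 2 * (A - l j) / \<kappa>)"
  proof (intro sum_mono)
    fix j
    \<comment> \<open>Using \<open>A - l j\<close> in place of \<open>- l j\<close> keeps the length
      nonnegative even when \<open>l j\<close> is positive.\<close>
    define x where "x = 2 * (A - l j) / \<kappa>"
    have x: "x \<ge> 0" using assms unfolding x_def by simp
    have "{1..m} \<inter> {n. P n j} \<subseteq> {Suc j..Suc j + nat \<lfloor>x\<rfloor>}"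
    proof
      fix n assume "n \<in> {1..m} \<inter> {n. P n j}"
      then have n: "j < n" "2 * l j < - \<kappa> * (real n - 1 - real j)"
        unfolding P_def shadowing_def by auto
      then have "(real n - 1 - real j) * \<kappa> \<le> 2 * (A - l j)"
        using assms(3) by (simp add: algebra_simps)
      then have "real n - 1 - real j \<le> x"
        using assms(1) unfolding x_def by (simp add: pos_le_divide_eq)
      then have "real (n - Suc j) \<le> x" using n(1) by (simp add: of_nat_diff)
      then have "n - Suc j \<le> nat \<lfloor>x\<rfloor>" by linarith
      then show "n \<in> {Suc j..Suc j + nat \<lfloor>x\<rfloor>}" using n(1) by auto
    qed
    then have "card ({1..m} \<inter> {n. P n j}) \<le> card {Suc j..Suc j + nat \<lfloor>x\<rfloor>}"
      by (intro card_mono) auto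
    also have "\<dots> = nat \<lfloor>x\<rfloor> + 1" by simp
    finally have "real (card ({1..m} \<inter> {n. P n j})) \<le> 1 + x" using x by linarith
    then show "(\<Sum>n\<in>{1..m}. of_bool (P n j)) \<le> 1 + 2 * (A - l j) / \<kappa>"
      unfolding x_def by simp
  qed
  also have "\<dots> = real m * (1 + 2 * A / \<kappa>) - 2 / \<kappa> * sum l {..<m}"
    by (simp add: sum.distrib sum_subtractf sum_distrib_left sum_divide_distrib diff_divide_distrib algebra_simps)
  also have "\<dots> \<le> real m * (1 + 2 * A / \<kappa>)" using assms by simp
  finally show ?thesis .
qed

text \<open>Pliss's lemma for \<open>l j - \<eta>\<close> gives at least
  \<open>\<sigma> / A * m\<close> expanding times; by Markov's inequality at most half that number
  of times lie in more than \<open>N\<close> shadows. The choice of \<open>N\<close> precedes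
  \<open>l\<close> and \<open>m\<close>.\<close>

lemma good_times_density:
  assumes "\<kappa> > 0" "\<sigma> > 0" "\<eta> \<ge> 0" "A > 0"
  obtains N :: nat where "N > 0"
    "\<And>l m. \<lbrakk>\<And>j. l j \<le> A; real m * (\<eta> + \<sigma>) \<le> sum l {..<m}\<rbrakk> \<Longrightarrow>
       \<sigma> / (2 * A) * real m \<le> card {n \<in> {1..m}.
         (\<forall>k<n. \<eta> * (real n - real k) \<le> sum l {k..<n}) \<and> card (shadowing l \<kappa> n) \<le> N}"
proof -
  define K where "K = 1 + 2 * A / \<kappa>"
  \<comment> \<open>\<open>K\<close> bounds the mean number of shadows, so this choice leaves at
    most \<open>\<sigma> / (2 * A) * m\<close> elements in the exceptional set
    \<open>Q\<close>.\<close>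
  obtain N :: nat where N: "N > K * (2 * A) / \<sigma>" using reals_Archimedean2 by blast
  have "K > 0" using assms unfolding K_def by (simp add: add_pos_pos)
  then have "0 < K * (2 * A) / \<sigma>" using assms by simp
  then have "N > 0" using N by (metis less_trans of_nat_0_less_iff)
  show ?thesis
  proof (rule that[OF \<open>N > 0\<close>])
    fix l m assume l: "\<And>j. l j \<le> A" and sum: "real m * (\<eta> + \<sigma>) \<le> sum l {..<m}"
    define P where "P = {n \<in> {1..m}. \<forall>k<n. \<eta> * (real n - real k) \<le> sum l {k..<n}}"
    define Q where "Q = {n \<in> {1..m}. card (shadowing l \<kappa> n) > N}"
    have fin: "finite P" "finite Q" unfolding P_def Q_def by auto
    have shift: "sum (\<lambda>j. l j - \<eta>) {k..<n} = sum l {k..<n} - \<eta> * (real n - real k)"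
      if "k < n" for k n
      using that by (simp add: sum_subtractf of_nat_diff)
    have "real m * \<sigma> \<le> sum (\<lambda>j. l j - \<eta>) {..<m}"
      using sum by (simp add: sum_subtractf algebra_simps)
    also have "\<dots> \<le> A * card {n \<in> {1..m}. \<forall>k<n. 0 \<le> sum (\<lambda>j. l j - \<eta>) {k..<n}}"
      using l assms by (intro card_nonneg_suffix_sums_ge) (auto intro: add_increasing2 simp: diff_le_eq)
    also have "{n \<in> {1..m}. \<forall>k<n. 0 \<le> sum (\<lambda>j. l j - \<eta>) {k..<n}} = P"
      unfolding P_def by (auto simp: shift)
    finally have P: "real m * \<sigma> \<le> A * card P" .
    have "real N * card Q = (\<Sum>n\<in>Q. real N)" by simp
    also have "\<dots> \<le> (\<Sum>n\<in>Q. real (card (shadowing l \<kappa> n)))"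
      by (intro sum_mono) (auto simp: Q_def)
    also have "\<dots> \<le> (\<Sum>n\<in>{1..m}. real (card (shadowing l \<kappa> n)))"
      by (intro sum_mono2) (auto simp: Q_def)
    also have "\<dots> \<le> real m * K"
    proof -
      have "0 \<le> real m * (\<eta> + \<sigma>)" using assms by simp
      then have "0 \<le> sum l {..<m}" using sum by linarith
      then show ?thesis unfolding K_def using l assms
        by (intro sum_card_shadowing_le) auto
    qed
    finally have "2 * A * (real N * card Q) \<le> 2 * A * (real m * K)"
      using assms by simp
    also have "\<dots> = real m * (K * (2 * A))" by simp
    also have "\<dots> \<le> real m * (real N * \<sigma>)"
      using N assms by (intro mult_left_mono) (auto simp: pos_divide_less_eq)
    finally have "real N * (2 * A * card Q) \<le> real N * (real m * \<sigma>)" by (simp add: mult_ac)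
    then have Q: "2 * A * card Q \<le> real m * \<sigma>" using \<open>N > 0\<close> by simp
    have "card P \<le> card (P - Q) + card Q"
      using fin by (metis add.commute card_Un_le card_mono finite_Diff finite_Un
        Un_Diff_cancel Un_upper2 order_trans)
    then have "A * card P \<le> A * (card (P - Q) + card Q)"
      using assms by (intro mult_left_mono of_nat_mono) auto
    then have "A * card P \<le> A * card (P - Q) + A * card Q" by (simp add: distrib_left)
    then have "real m * \<sigma> \<le> 2 * A * card (P - Q)" using P Q by linarith
    then have "\<sigma> / (2 * A) * real m \<le> card (P - Q)"
      using assms by (simp add: pos_divide_le_eq mult_ac)
    also have "P - Q = {n \<in> {1..m}.
         (\<forall>k<n. \<eta> * (real n - real k) \<le> sum l {k..<n}) \<and> card (shadowing l \<kappa> n) \<le> N}"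
      unfolding P_def Q_def by auto
    finally show "\<sigma> / (2 * A) * real m \<le> card {n \<in> {1..m}.
         (\<forall>k<n. \<eta> * (real n - real k) \<le> sum l {k..<n}) \<and> card (shadowing l \<kappa> n) \<le> N}" .
  qed
qed

section \<open>Pulling a disk back along an orbit\<close>

lemma DERIV_funpow_poly:
  fixes g :: "complex poly"
  shows "((poly g ^^ n) has_field_derivative (\<Prod>j<n. poly (pderiv g) ((poly g ^^ j) z))) (at z)"
proof (induction n)
  case 0
  then show ?case by (simp add: id_def)
next
  case (Suc n)
  have "((\<lambda>x. poly g ((poly g ^^ n) x)) has_field_derivative
      poly (pderiv g) ((poly g ^^ n) z) * (\<Prod>j<n. poly (pderiv g) ((poly g ^^ j) z))) (at z)"
    by (rule DERIV_chain2[OF poly_DERIV Suc])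
  then show ?case by (simp add: o_def mult.commute)
qed

lemma continuous_on_funpow_poly [continuous_intros]:
  fixes g :: "complex poly"
  shows "continuous_on S (poly g ^^ n)"
  using DERIV_funpow_poly by (intro continuous_at_imp_continuous_on ballI DERIV_isCont) blast

text \<open>Induction backwards from \<open>n\<close>, with \<open>rad j\<close> the radius allowed
  at time \<open>j\<close>. The surplus \<open>\<delta>\<close> in the hyperbolicity pays for the
  distortion \<open>exp \<delta>\<close> of each step, so the radii still decay at rate
  \<open>\<kappa>\<close>; outside the shadowing set this decay brings them within reach of
  \<open>good\<close>.\<close>

lemma pullback_along_good_time:
  fixes g :: "complex poly" and z :: complex
  defines "x \<equiv> \<lambda>j. (poly g ^^ j) z"
  defines "l \<equiv> \<lambda>j. ln (cmod (poly (pderiv g) (x j)))"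
  assumes nz: "\<And>j. j < n \<Longrightarrow> poly (pderiv g) (x j) \<noteq> 0"
    and hyp: "\<And>k. k < n \<Longrightarrow> (\<kappa> + \<delta>) * (real n - real k) \<le> sum l {k..<n}"
    and card: "card (shadowing l \<kappa> n) \<le> N"
    and pos: "\<delta> > 0" "rho > 0"
    and rho_le: "rho * (8 ^ degree g) ^ N \<le> rho1"
    and good: "\<And>j r W. \<lbrakk>j < n; r > 0; r \<le> rho1 * cmod (poly (pderiv g) (x j)) ^ 2; connected W;
       x j \<in> W; poly g ` W \<subseteq> ball (poly g (x j)) r\<rbrakk> \<Longrightarrow>
       W \<subseteq> ball (x j) (exp \<delta> * r / cmod (poly (pderiv g) (x j))) \<and> W \<inter> crit_points g = {}"
    and V: "connected V" "z \<in> V" "(poly g ^^ n) ` V \<subseteq> ball (x n) rho"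
  shows "V \<subseteq> ball z (rho * (8 ^ degree g) ^ N * exp (- \<kappa> * real n))"
    and "at_most_N_critical g n V N"
proof -
  define C where "C = (8::real) ^ degree g"
  define S where "S = shadowing l \<kappa> n"
  \<comment> \<open>Closed form of the recursion \<open>rad_Suc\<close> with
    \<open>rad n = rho\<close>: a factor \<open>C\<close> for each shadowing time,
    \<open>exp \<delta>\<close> for every step, and division by the derivatives.\<close>
  define rad where "rad j = rho * C ^ card (S \<inter> {j..}) *
    exp (\<delta> * (real n - real j) - sum l {j..<n})" for j
  have C: "C \<ge> 1" unfolding C_def by simp
  have rad_pos: "rad j > 0" for j using pos C unfolding rad_def by simp
  have rad_le: "rad j \<le> rho * C ^ N * exp (- \<kappa> * (real n - real j))" if "j \<le> n" for j
  proof -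
    have "card (S \<inter> {j..}) \<le> N"
      using card card_mono[of S "S \<inter> {j..}"] unfolding S_def by simp
    moreover have "\<delta> * (real n - real j) - sum l {j..<n} \<le> - \<kappa> * (real n - real j)"
      using hyp[of j] that by (cases "j = n") (auto simp: algebra_simps)
    ultimately show ?thesis unfolding rad_def using pos C
      by (intro mult_mono mult_left_mono power_increasing) auto
  qed
  have conn: "connected ((poly g ^^ j) ` V)" for j
    using V(1) by (intro connected_continuous_image continuous_intros)
  have xV: "x j \<in> (poly g ^^ j) ` V" for j using V(2) unfolding x_def by blast
  have img: "poly g ` (poly g ^^ j) ` V = (poly g ^^ Suc j) ` V" for j by (simp add: image_comp)
  have xS: "poly g (x j) = x (Suc j)" for j unfolding x_def by simp
  have rad_Suc: "rad j = (if j \<in> S then C else 1) * (exp \<delta> * rad (Suc j) /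
      cmod (poly (pderiv g) (x j)))" if "j < n" for j
  proof -
    have "S \<inter> {j..} = (if j \<in> S then insert j (S \<inter> {Suc j..}) else S \<inter> {Suc j..})"
      by (auto simp: Suc_le_eq order_le_less)
    then have "C ^ card (S \<inter> {j..}) = (if j \<in> S then C else 1) * C ^ card (S \<inter> {Suc j..})"
      by (simp add: S_def)
    moreover have "sum l {j..<n} = l j + sum l {Suc j..<n}"
      using that by (simp add: sum.atLeast_Suc_lessThan)
    then have "exp (\<delta> * (real n - real j) - sum l {j..<n}) =
        exp (\<delta> + (\<delta> * (real n - real (Suc j)) - sum l {Suc j..<n}) - l j)"
      by (simp add: algebra_simps)
    moreover have "exp (l j) = cmod (poly (pderiv g) (x j))"
      using nz[OF that] unfolding l_def by simp
    ultimately show ?thesis unfolding rad_def by (simp add: exp_add exp_diff)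
  qed
  have unshadowed: "W \<subseteq> ball (x j) (exp \<delta> * rad (Suc j) / cmod (poly (pderiv g) (x j))) \<and>
      W \<inter> crit_points g = {}"
    if "j < n" "j \<notin> S" "connected W" "x j \<in> W" "poly g ` W \<subseteq> ball (x (Suc j)) (rad (Suc j))" for j W
  proof (rule good)
    have "rad (Suc j) \<le> rho * C ^ N * exp (- \<kappa> * (real n - real (Suc j)))"
      using that by (intro rad_le) simp
    also have "\<dots> \<le> rho1 * exp (- \<kappa> * (real n - real (Suc j)))"
      using rho_le unfolding C_def by (intro mult_right_mono) auto
    also have "\<dots> \<le> rho1 * exp (2 * l j)"
    proof -
      have "rho1 \<ge> 0" using rho_le pos C unfolding C_def
        by (meson less_imp_le mult_nonneg_nonneg order_trans zero_le_numeral zero_le_power)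
      \<comment> \<open>Only the steps after \<open>j\<close> have been pulled back so far, hence
        \<open>Suc j\<close>; this is why shadows are measured by \<open>n - 1 - j\<close>.\<close>
      moreover have "- \<kappa> * (real n - real (Suc j)) \<le> 2 * l j"
        using that(1,2) unfolding S_def shadowing_def by (auto simp: algebra_simps)
      ultimately show ?thesis by (intro mult_left_mono) auto
    qed
    also have "exp (2 * l j) = cmod (poly (pderiv g) (x j)) ^ 2"
      using nz[OF that(1)] unfolding l_def by (simp add: exp_double)
    finally show "rad (Suc j) \<le> rho1 * cmod (poly (pderiv g) (x j)) ^ 2" .
  qed (use that rad_pos xS in auto)
  have sub: "(poly g ^^ j) ` V \<subseteq> ball (x j) (rad j)" if "j \<le> n" for j
    using that
  proof (induction j rule: inc_induct)
    case base
    have "S \<inter> {n..} = {}" unfolding S_def shadowing_def by auto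
    then show ?case using V(3) unfolding rad_def by simp
  next
    case (step j)
    let ?W = "(poly g ^^ j) ` V"
    have W: "poly g ` ?W \<subseteq> ball (x (Suc j)) (rad (Suc j))"
      using step.IH by (simp only: img)
    show ?case
    proof (cases "j \<in> S")
      case True
      have "?W \<subseteq> ball (x j) (8 ^ degree g * rad (Suc j) / cmod (poly (pderiv g) (x j)))"
        using conn xV W nz[OF step.hyps(2)] rad_pos
        by (intro connected_preimage_ball_subset) (auto simp: xS)
      also have "\<dots> \<subseteq> ball (x j) (rad j)"
      proof (rule subset_ball)
        \<comment> \<open>The crude bound carries the factor \<open>C\<close> alone;
          \<open>rad_Suc\<close> leaves \<open>exp \<delta>\<close> as slack.\<close>
        have "1 * (C * (rad (Suc j) / cmod (poly (pderiv g) (x j))))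
            \<le> exp \<delta> * (C * (rad (Suc j) / cmod (poly (pderiv g) (x j))))"
          using pos C rad_pos[of "Suc j"] by (intro mult_right_mono) auto
        then show "8 ^ degree g * rad (Suc j) / cmod (poly (pderiv g) (x j)) \<le> rad j"
          using rad_Suc[OF step.hyps(2)] True by (simp add: C_def mult_ac)
      qed
      finally show ?thesis .
    next
      case False
      then show ?thesis
        using unshadowed[OF step.hyps(2) False conn xV W] rad_Suc[OF step.hyps(2)] by simp
    qed
  qed
  have "V \<subseteq> ball z (rad 0)" using sub[of 0] unfolding x_def by simp
  also have "\<dots> \<subseteq> ball z (rho * C ^ N * exp (- \<kappa> * real n))"
    using rad_le[of 0] by (intro subset_ball) simp
  finally show "V \<subseteq> ball z (rho * (8 ^ degree g) ^ N * exp (- \<kappa> * real n))" unfolding C_def .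
  \<comment> \<open>At unshadowed times the pullback avoids the critical points, so the critical
    steps are among the at most \<open>N\<close> shadowing ones.\<close>
  have "{j \<in> {0..<n}. (poly g ^^ j) ` V \<inter> crit_points g \<noteq> {}} \<subseteq> S"
  proof
    fix j assume j: "j \<in> {j \<in> {0..<n}. (poly g ^^ j) ` V \<inter> crit_points g \<noteq> {}}"
    then have "poly g ` (poly g ^^ j) ` V \<subseteq> ball (x (Suc j)) (rad (Suc j))"
      using sub[of "Suc j"] by (simp only: img) auto
    then show "j \<in> S" using unshadowed[OF _ _ conn[of j] xV[of j]] j by auto
  qed
  then show "at_most_N_critical g n V N"
    unfolding at_most_N_critical_def using card card_mono[of S] unfolding S_def
    by (meson finite_shadowing le_trans)
qed

section \<open>Boundedness of orbits in the Julia set\<close>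

lemma chordal_dist_le_twice: "chordal_dist a b \<le> 2 * cmod (a - b)"
proof -
  have "1 * 1 \<le> (1 + (cmod a)\<^sup>2) * (1 + (cmod b)\<^sup>2)" by (intro mult_mono) auto
  then have "1 \<le> sqrt ((1 + (cmod a)\<^sup>2) * (1 + (cmod b)\<^sup>2))" by simp
  then have "2 * cmod (a - b) / sqrt ((1 + (cmod a)\<^sup>2) * (1 + (cmod b)\<^sup>2)) \<le> 2 * cmod (a - b) / 1"
    by (intro divide_left_mono) auto
  then show ?thesis unfolding chordal_dist_def by simp
qed

lemma chordal_dist_near_infinity:
  assumes "T > 0" "cmod a \<ge> T" "cmod b \<ge> T"
  shows "chordal_dist a b \<le> 4 / T"
proof -
  have pos: "cmod a > 0" "cmod b > 0" using assms by linarith+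
  have "cmod a * cmod b = sqrt ((cmod a)\<^sup>2 * (cmod b)\<^sup>2)" by (simp add: real_sqrt_mult)
  also have "\<dots> \<le> sqrt ((1 + (cmod a)\<^sup>2) * (1 + (cmod b)\<^sup>2))"
    by (intro real_sqrt_le_mono mult_mono) auto
  finally have "chordal_dist a b \<le> 2 * (cmod a + cmod b) / (cmod a * cmod b)"
    unfolding chordal_dist_def using pos norm_triangle_ineq4[of a b] by (intro frac_le) auto
  also have "\<dots> = 2 / cmod b + 2 / cmod a" using pos by (simp add: field_simps)
  also have "\<dots> \<le> 2 / T + 2 / T" using assms pos by (intro add_mono divide_left_mono) auto
  finally show ?thesis by simp
qed

text \<open>Write \<open>g w = a + w * p w\<close>. Degree at least 2 makes \<open>p\<close>
  nonconstant, so far out \<open>cmod (p w)\<close> is at least 3, while the constant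
  \<open>a\<close> costs at most \<open>cmod w\<close>.\<close>

lemma poly_escape_radius:
  fixes g :: "complex poly"
  assumes "degree g \<ge> 2"
  obtains R where "R \<ge> 1" "\<And>w. cmod w > R \<Longrightarrow> cmod (poly g w) \<ge> 2 * cmod w"
proof -
  obtain a p where g: "g = pCons a p" by (cases g)
  obtain b q where p: "p = pCons b q" by (cases p)
  have "q \<noteq> 0" using assms unfolding g p by (auto split: if_splits)
  then obtain r where r: "\<And>w. r \<le> cmod w \<Longrightarrow> 3 \<le> cmod (poly p w)"
    using poly_infinity[of q 3 b] unfolding p by blast
  show ?thesis
  proof (rule that[of "max 1 (max r (cmod a))"])
    fix w assume w: "cmod w > max 1 (max r (cmod a))"
    then have "cmod w * 3 \<le> cmod w * cmod (poly p w)" using r[of w] by (intro mult_left_mono) auto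
    also have "\<dots> = cmod (poly g w - a)" unfolding g by (simp add: norm_mult)
    also have "\<dots> \<le> cmod (poly g w) + cmod a" by (rule norm_triangle_ineq4)
    finally show "cmod (poly g w) \<ge> 2 * cmod w" using w by simp
  qed simp
qed

text \<open>On \<open>U\<close> the orbits grow uniformly after time \<open>j\<close>, so late
  iterates are chordally close at once; continuity handles the finitely many early ones.\<close>

lemma escaping_in_fatou_set:
  fixes g :: "complex poly"
  assumes R: "R \<ge> 1" and esc: "\<And>w. cmod w > R \<Longrightarrow> cmod (poly g w) \<ge> 2 * cmod w"
    and z: "cmod ((poly g ^^ j) z) > R"
  shows "z \<in> fatou_set g"
proof -
  define U where "U = (poly g ^^ j) -` {w. cmod w > R}"
  have "open U" unfolding U_def
    by (intro open_vimage continuous_intros open_Collect_less)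
  have "z \<in> U" using z unfolding U_def by simp
  have big: "cmod ((poly g ^^ (i + j)) u) > R \<and> cmod ((poly g ^^ (i + j)) u) \<ge> 2 ^ i" if "u \<in> U" for i u
  proof (induction i)
    case 0
    then show ?case using that R unfolding U_def by auto
  next
    case (Suc i)
    then show ?case using esc[of "(poly g ^^ (i + j)) u"] R by auto
  qed
  have "\<exists>d>0. \<forall>n. \<forall>u\<in>U. cmod (u - w) < d \<longrightarrow>
      chordal_dist ((poly g ^^ n) u) ((poly g ^^ n) w) < e" if w: "w \<in> U" and e: "e > 0" for w e
  proof -
    \<comment> \<open>From time \<open>i0 + j\<close> on, orbits from \<open>U\<close> have modulus
      at least \<open>2 ^ i0\<close>, which puts their chordal distances below
      \<open>e\<close>.\<close>
    obtain i0 where i0: "4 / e < 2 ^ i0" using real_arch_pow[of 2 "4 / e"] by auto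
    have "\<exists>d>0. \<forall>u. cmod (u - w) < d \<longrightarrow> cmod ((poly g ^^ n) u - (poly g ^^ n) w) < e / 2" for n
      using DERIV_isCont[OF DERIV_funpow_poly[of n g w]] e
      unfolding continuous_at_eps_delta dist_norm by (meson half_gt_zero)
    then obtain d where d: "\<And>n. d n > 0"
      "\<And>n u. cmod (u - w) < d n \<Longrightarrow> cmod ((poly g ^^ n) u - (poly g ^^ n) w) < e / 2" by metis
    define d0 where "d0 = Min (d ` {..i0 + j})"
    have "d0 > 0" unfolding d0_def using d(1) by (subst Min_gr_iff) auto
    moreover have "chordal_dist ((poly g ^^ n) u) ((poly g ^^ n) w) < e"
      if u: "u \<in> U" "cmod (u - w) < d0" for n u
    proof (cases "n \<le> i0 + j")
      case True
      then have "d0 \<le> d n" unfolding d0_def by (intro Min_le) auto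
      then show ?thesis
        using d(2)[of u n] u chordal_dist_le_twice[of "(poly g ^^ n) u" "(poly g ^^ n) w"] by linarith
    next
      case False
      then obtain i where i: "n = i + j" "i0 \<le> i" by (metis le_add_diff_inverse2 add_le_cancel_right nat_le_linear trans_le_add2)
      then have "chordal_dist ((poly g ^^ n) u) ((poly g ^^ n) w) \<le> 4 / 2 ^ i"
        using big u w by (intro chordal_dist_near_infinity) auto
      also have "\<dots> \<le> 4 / 2 ^ i0" using i by (intro divide_left_mono power_increasing) auto
      also have "\<dots> < e" using i0 e by (simp add: field_simps)
      finally show ?thesis .
    qed
    ultimately show ?thesis by blast
  qed
  with \<open>open U\<close> \<open>z \<in> U\<close> show ?thesis unfolding fatou_set_def by blast
qed

text \<open>One disk contains all these orbits, so the bounds on derivatives and the scale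
  \<open>rho1\<close> can be chosen independently of \<open>z\<close>.\<close>

lemma julia_orbit_bounded:
  assumes "degree g \<ge> 2"
  obtains R where "\<And>z j. z \<in> julia_set g \<Longrightarrow> cmod ((poly g ^^ j) z) \<le> R"
proof -
  obtain R where "R \<ge> 1" "\<And>w. cmod w > R \<Longrightarrow> cmod (poly g w) \<ge> 2 * cmod w"
    using poly_escape_radius[OF assms] by blast
  then show ?thesis
    using that[of R] escaping_in_fatou_set[of R g] unfolding julia_set_def by (metis ComplD not_le)
qed

section \<open>Choice of the constants and conclusion\<close>

theorem theorem3p1:
  fixes g :: "complex poly"
  assumes "degree g \<ge> 2"
  shows "\<forall>lam::real. \<forall>eps0::real. lam > 1 \<and> eps0 > 0 \<longrightarrow>
    (\<exists>rho::real. \<exists>N::nat. \<exists>nt::nat. \<exists>alpha::real. rho > 0 \<and> N > 0 \<and> nt > 0 \<and> alpha > 0 \<and>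
      (\<forall>z \<in> julia_set g. \<forall>m::nat. m > 0 \<longrightarrow>
         ln (cmod (deriv (poly g ^^ m) z)) / real m > eps0 + ln lam \<longrightarrow>
         (\<exists>H. H \<subseteq> {1..m} \<and> alpha * real m \<le> real (card H) \<and>
            (\<forall>n\<in>H.
               let V = connected_component_set ((poly g ^^ n) -` ball ((poly g ^^ n) z) rho) z
               in at_most_N_critical g n V N \<and>
                  (n \<ge> nt \<longrightarrow> V \<subseteq> ball z (rho / lam ^ n))))))"
proof (intro allI impI)
  fix lam eps0 :: real
  assume "lam > 1 \<and> eps0 > 0"
  then have lam: "lam > 1" and eps: "eps0 > 0" by auto
  \<comment> \<open>The rate \<open>ln lam + eps0\<close> is split as
    \<open>\<kappa> + \<delta> + eps0 / 2\<close>: \<open>\<kappa>\<close> is the contraction to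
    keep, \<open>\<delta>\<close> covers the distortion, and \<open>eps0 / 2\<close> is the surplus
    that yields positive density.\<close>
  define \<delta> where "\<delta> = eps0 / 4"
  define \<kappa> where "\<kappa> = ln lam + eps0 / 4"
  have pos: "\<delta> > 0" "\<kappa> > 0" using lam eps unfolding \<delta>_def \<kappa>_def by (auto intro: add_pos_pos)
  obtain R where R: "\<And>z j. z \<in> julia_set g \<Longrightarrow> cmod ((poly g ^^ j) z) \<le> R"
    using julia_orbit_bounded[OF assms] by blast
  have "bounded (poly (pderiv g) ` cball 0 R)"
    by (intro compact_imp_bounded compact_continuous_image continuous_intros compact_cball)
  then obtain L where "L > 0" and L: "\<And>y. cmod y \<le> R \<Longrightarrow> cmod (poly (pderiv g) y) \<le> L"
    unfolding bounded_pos by auto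
  define A where "A = max 1 (ln L)"
  have A: "A > 0" unfolding A_def by simp
  have "eps0 / 2 > 0" "\<kappa> + \<delta> \<ge> 0" using eps pos by auto
  then obtain N where "N > 0" and N: "\<And>l m. \<lbrakk>\<And>j. l j \<le> A; real m * ((\<kappa> + \<delta>) + eps0 / 2) \<le> sum l {..<m}\<rbrakk> \<Longrightarrow>
       (eps0 / 2) / (2 * A) * real m \<le> card {n \<in> {1..m}.
         (\<forall>k<n. (\<kappa> + \<delta>) * (real n - real k) \<le> sum l {k..<n}) \<and> card (shadowing l \<kappa> n) \<le> N}"
    using good_times_density[OF pos(2) _ _ A] by blast
  have "exp \<delta> > 1" using pos by simp
  then obtain rho1 where "rho1 > 0" and rho1:
    "\<And>y W r. \<lbrakk>cmod y \<le> R; poly (pderiv g) y \<noteq> 0; r > 0; r \<le> rho1 * cmod (poly (pderiv g) y) ^ 2;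
       connected W; y \<in> W; poly g ` W \<subseteq> ball (poly g y) r\<rbrakk> \<Longrightarrow>
       W \<subseteq> ball y (exp \<delta> * r / cmod (poly (pderiv g) y)) \<and> W \<inter> crit_points g = {}"
    using connected_preimage_small_ball[of "exp \<delta>" R g] by blast
  define D where "D = ((8::real) ^ degree g) ^ N"
  have D: "D \<ge> 1" unfolding D_def by simp
  \<comment> \<open>Even \<open>N\<close> crude factors, of total size \<open>D\<close>, keep the
    radius within the scale \<open>rho1\<close>.\<close>
  define rho where "rho = rho1 / D"
  have rho: "rho > 0" "rho * D = rho1" using D \<open>rho1 > 0\<close> unfolding rho_def by auto
  obtain nt :: nat where nt: "nt > ln D / \<delta>" using reals_Archimedean2 by blast
  define alpha where "alpha = (eps0 / 2) / (2 * A)"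
  \<comment> \<open>Since \<open>\<kappa> = ln lam + \<delta>\<close>, the factor
    \<open>exp (- \<delta> * n)\<close> absorbs \<open>D\<close> once \<open>n\<close> exceeds
    \<open>ln D / \<delta>\<close>.\<close>
  have shrink: "rho * D * exp (- \<kappa> * real n) \<le> rho / lam ^ n" if "n \<ge> Suc nt" for n
  proof -
    have "ln D \<le> \<delta> * nt" using nt pos by (simp add: pos_divide_less_eq mult.commute)
    also have "\<dots> \<le> \<delta> * n" using that pos by (intro mult_left_mono) auto
    finally have "exp (ln D) \<le> exp (\<delta> * n)" by simp
    then have "D \<le> exp (\<delta> * n)" using D by simp
    then have "D * exp (- \<kappa> * n) \<le> exp (\<delta> * n) * exp (- \<kappa> * n)"
      by (intro mult_right_mono) auto
    moreover have "exp (\<delta> * n) * exp (- \<kappa> * n) = 1 / lam ^ n"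
    proof -
      have "lam ^ n = exp (real n * ln lam)" using lam by (simp add: exp_of_nat_mult)
      then have "exp (\<kappa> * n) = exp (\<delta> * n) * lam ^ n"
        unfolding \<kappa>_def \<delta>_def by (simp add: exp_add[symmetric] algebra_simps)
      then show ?thesis by (simp add: exp_minus divide_inverse)
    qed
    ultimately have "D * exp (- \<kappa> * n) \<le> 1 / lam ^ n" by linarith
    then have "rho * (D * exp (- \<kappa> * n)) \<le> rho * (1 / lam ^ n)" using rho by (intro mult_left_mono) auto
    then show ?thesis by simp
  qed
  show "\<exists>rho N nt alpha. rho > 0 \<and> N > 0 \<and> nt > 0 \<and> alpha > 0 \<and>
      (\<forall>z \<in> julia_set g. \<forall>m::nat. m > 0 \<longrightarrow>
         ln (cmod (deriv (poly g ^^ m) z)) / real m > eps0 + ln lam \<longrightarrow>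
         (\<exists>H. H \<subseteq> {1..m} \<and> alpha * real m \<le> real (card H) \<and>
            (\<forall>n\<in>H.
               let V = connected_component_set ((poly g ^^ n) -` ball ((poly g ^^ n) z) rho) z
               in at_most_N_critical g n V N \<and>
                  (n \<ge> nt \<longrightarrow> V \<subseteq> ball z (rho / lam ^ n)))))"
  proof (rule exI[of _ rho], rule exI[of _ N], rule exI[of _ "Suc nt"], rule exI[of _ alpha],
      intro conjI ballI allI impI)
    fix z m
    assume z: "z \<in> julia_set g" and m: "0 < m"
      and expand: "eps0 + ln lam < ln (cmod (deriv (poly g ^^ m) z)) / real m"
    define a where "a j = cmod (poly (pderiv g) ((poly g ^^ j) z))" for j
    define l where "l j = ln (a j)" for j
    define H where "H = {n \<in> {1..m}. (\<forall>k<n. (\<kappa> + \<delta>) * (real n - real k) \<le> sum l {k..<n}) \<and>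
      card (shadowing l \<kappa> n) \<le> N}"
    have deriv: "cmod (deriv (poly g ^^ m) z) = (\<Prod>j<m. a j)"
      unfolding a_def using DERIV_imp_deriv[OF DERIV_funpow_poly[of m g z]] by (simp add: prod_norm)
    have "0 < eps0 + ln lam" using eps lam by (simp add: add_pos_pos)
    \<comment> \<open>As \<open>ln 0 = 0\<close> in HOL, a vanishing derivative would give growth
      rate 0, contrary to \<open>expand\<close>.\<close>
    have "(\<Prod>j<m. a j) \<noteq> 0"
    proof
      assume "(\<Prod>j<m. a j) = 0"
      then show False using expand \<open>0 < eps0 + ln lam\<close> unfolding deriv by (simp only:) simp
    qed
    then have nz: "a j \<noteq> 0" if "j < m" for j using that by auto
    have "eps0 + ln lam < sum l {..<m} / m"
      using expand nz unfolding deriv l_def by (subst (asm) ln_prod) (auto simp: a_def)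
    then have sum: "real m * ((\<kappa> + \<delta>) + eps0 / 2) \<le> sum l {..<m}"
      using m unfolding \<kappa>_def \<delta>_def by (simp add: field_simps)
    \<comment> \<open>Required for every \<open>j\<close>, also beyond \<open>m\<close>, where
      \<open>a j\<close> may vanish and then \<open>l j = 0\<close>.\<close>
    have l_le: "l j \<le> A" for j
    proof (cases "a j = 0")
      case True
      then show ?thesis using A unfolding l_def by simp
    next
      case False
      then have "0 < a j" unfolding a_def by simp
      moreover have "a j \<le> L" using L[OF R[OF z]] unfolding a_def .
      ultimately have "ln (a j) \<le> ln L" by simp
      then show ?thesis unfolding l_def A_def by simp
    qed
    show "\<exists>H. H \<subseteq> {1..m} \<and> alpha * real m \<le> real (card H) \<and>
            (\<forall>n\<in>H.
               let V = connected_component_set ((poly g ^^ n) -` ball ((poly g ^^ n) z) rho) z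
               in at_most_N_critical g n V N \<and>
                  (n \<ge> Suc nt \<longrightarrow> V \<subseteq> ball z (rho / lam ^ n)))"
    proof (intro exI[of _ H] conjI ballI)
      show "H \<subseteq> {1..m}" unfolding H_def by auto
      show "alpha * real m \<le> real (card H)" unfolding alpha_def H_def by (rule N[OF l_le sum])
      fix n assume "n \<in> H"
      then have n: "n \<le> m" "\<And>k. k < n \<Longrightarrow> (\<kappa> + \<delta>) * (real n - real k) \<le> sum l {k..<n}"
        "card (shadowing l \<kappa> n) \<le> N" unfolding H_def by auto
      define V where "V = connected_component_set ((poly g ^^ n) -` ball ((poly g ^^ n) z) rho) z"
      have V: "connected V" "z \<in> V" "(poly g ^^ n) ` V \<subseteq> ball ((poly g ^^ n) z) rho"
        unfolding V_def using rho connected_component_subset by fastforce+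
      have nz': "poly (pderiv g) ((poly g ^^ j) z) \<noteq> 0" if "j < n" for j
        using nz[of j] that n(1) unfolding a_def by auto
      have "rho * (8 ^ degree g) ^ N \<le> rho1" using rho(2) unfolding D_def by simp
      note pullback_along_good_time[OF nz' n(2,3)[unfolded l_def a_def] pos(1) rho(1) this
          rho1[OF R[OF z] nz'] V]
      moreover have "ball z (rho * D * exp (- \<kappa> * real n)) \<subseteq> ball z (rho / lam ^ n)" if "n \<ge> Suc nt"
        using shrink[OF that] by (rule subset_ball)
      ultimately show "let V = connected_component_set ((poly g ^^ n) -` ball ((poly g ^^ n) z) rho) z
               in at_most_N_critical g n V N \<and>
                  (n \<ge> Suc nt \<longrightarrow> V \<subseteq> ball z (rho / lam ^ n))"
        unfolding Let_def V_def[symmetric] D_def by blast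
    qed
  qed (use rho \<open>N > 0\<close> eps A in \<open>auto simp: alpha_def\<close>)
qed

end
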